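(* Let $\mathcal C=((V_1,q_1),(V_2,q_2),(V_3,q_3),*_3)$ be a composition of quadratic spaces of dimension $8$ over a field $F$, with derived composition map $*_1\colon V_2\times V_3\to V_1$. For every $g_1\in\mathfrak{go}(q_1)$, there exist $g_2\in\mathfrak{go}(q_2)$ and $g_3\in\mathfrak{go}(q_3)$ such that $$g_1(x_2*_1x_3)=g_2(x_2)*_1x_3+x_2*_1g_3(x_3)+\dot\mu(g_1)\,x_2*_1x_3\qquad\text{for all }x_2\in V_2,\ x_3\in V_3.$$
   Context: $F$ is a field of arbitrary characteristic. A composition of quadratic spaces over $F$ is a 4-tuple $((V_1,q_1),(V_2,q_2),(V_3,q_3),*_3)$ where the $(V_i,q_i)$ are finite-dimensional quadratic spaces of the same dimension (the dimension of the composition) with nonsingular polar forms $b_i(x,y)=q_i(x+y)-q_i(x)-q_i(y)$, and $*_3\colon V_1\times V_2\to V_3$ is bilinear with $q_3(x_1*_3x_2)=q_1(x_1)q_2(x_2)$. The derived map $*_1\colon V_2\times V_3\to V_1$ is the bilinear map determined by $b_1(x_1,x_2*_1x_3)=b_3(x_3,x_1*_3x_2)$ for all $x_i\in V_i$. For a quadratic space $(V,q)$ with nonsingular polar form $b$, $\mathfrak{go}(q)$ is the Lie algebra of the group scheme of similitudes of $(V,q)$: it consists of the $g\in\mathrm{End}_F(V)$ for which there is a scalar $\mu\in F$ with $b(g(u),u)=\mu\,q(u)$ for all $u\in V$; this scalar is denoted $\dot\mu(g)$ (equivalently $\dot\mu(g)=\sigma_b(g)+g$, with $\sigma_b$ the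 adjoint involution of $b$). *)

theory Defs
  imports Complex_Main
begin

definition bilinear_map ::
    "('f::field \<Rightarrow> 'a::ab_group_add \<Rightarrow> 'a) \<Rightarrow> ('f \<Rightarrow> 'b::ab_group_add \<Rightarrow> 'b) \<Rightarrow>
     ('f \<Rightarrow> 'c::ab_group_add \<Rightarrow> 'c) \<Rightarrow> ('a \<Rightarrow> 'b \<Rightarrow> 'c) \<Rightarrow> bool" where
  "bilinear_map s1 s2 s3 m \<longleftrightarrow>
     (\<forall>x. Vector_Spaces.linear s2 s3 (\<lambda>y. m x y)) \<and>
     (\<forall>y. Vector_Spaces.linear s1 s3 (\<lambda>x. m x y))"

definition polar :: "('v::ab_group_add \<Rightarrow> 'f::field) \<Rightarrow> 'v \<Rightarrow> 'v \<Rightarrow> 'f" where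
  "polar q x y = q (x + y) - q x - q y"

text \<open>The underlying vector space of a quadratic space is a whole type, with an explicit scalar
  multiplication.\<close>

locale quadratic_space = vector_space scale
  for scale :: "'f::field \<Rightarrow> 'v::ab_group_add \<Rightarrow> 'v" +
  fixes q :: "'v \<Rightarrow> 'f"
  assumes finite_dim: "\<exists>B. finite B \<and> span B = UNIV"
    and q_scale: "q (scale c x) = c\<^sup>2 * q x"
    and polar_bilinear: "bilinear_map scale scale (*) (polar q)"

locale nonsingular_quadratic_space = quadratic_space +
  assumes nonsingular: "(\<And>y. polar q x y = 0) \<Longrightarrow> x = 0"

locale quadratic_composition =
  V1: nonsingular_quadratic_space s1 q1 +
  V2: nonsingular_quadratic_space s2 q2 +
  V3: nonsingular_quadratic_space s3 q3
  for s1 :: "'f::field \<Rightarrow> 'a::ab_group_add \<Rightarrow> 'a" and q1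
    and s2 :: "'f \<Rightarrow> 'b::ab_group_add \<Rightarrow> 'b" and q2
    and s3 :: "'f \<Rightarrow> 'c::ab_group_add \<Rightarrow> 'c" and q3 +
  fixes star3 :: "'a \<Rightarrow> 'b \<Rightarrow> 'c"
    and n :: nat
  assumes dim1: "V1.dim UNIV = n"
    and dim2: "V2.dim UNIV = n"
    and dim3: "V3.dim UNIV = n"
    and star3_bilinear: "bilinear_map s1 s2 s3 star3"
    and star3_mult: "q3 (star3 x1 x2) = q1 x1 * q2 x2"

definition derived_star1 ::
    "('f::field \<Rightarrow> 'a::ab_group_add \<Rightarrow> 'a) \<Rightarrow> ('a \<Rightarrow> 'f) \<Rightarrow>
     ('f \<Rightarrow> 'b::ab_group_add \<Rightarrow> 'b) \<Rightarrow>
     ('f \<Rightarrow> 'c::ab_group_add \<Rightarrow> 'c) \<Rightarrow> ('c \<Rightarrow> 'f) \<Rightarrow>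
     ('a \<Rightarrow> 'b \<Rightarrow> 'c) \<Rightarrow> ('b \<Rightarrow> 'c \<Rightarrow> 'a)" where
  "derived_star1 s1 q1 s2 s3 q3 star3 =
     (THE star1. bilinear_map s2 s3 s1 star1 \<and>
        (\<forall>x1 x2 x3. polar q1 x1 (star1 x2 x3) = polar q3 x3 (star3 x1 x2)))"

definition go :: "('f::field \<Rightarrow> 'v::ab_group_add \<Rightarrow> 'v) \<Rightarrow> ('v \<Rightarrow> 'f) \<Rightarrow> ('v \<Rightarrow> 'v) set" where
  "go scale q =
     {g. Vector_Spaces.linear scale scale g \<and> (\<exists>\<mu>. \<forall>u. polar q (g u) u = \<mu> * q u)}"

text \<open>The scalar is unique as soon as \<open>q\<close> is not identically zero, which holds for nonsingular
  quadratic spaces of nonzero dimension.\<close>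

definition mu_dot :: "('v::ab_group_add \<Rightarrow> 'f::field) \<Rightarrow> ('v \<Rightarrow> 'v) \<Rightarrow> 'f" where
  "mu_dot q g = (THE \<mu>. \<forall>u. polar q (g u) u = \<mu> * q u)"

lemma polar_sym: "polar q x y = polar q y x"
  by (simp add: polar_def add.commute)

context quadratic_space
begin

lemma polar_linear_left: "Vector_Spaces.linear scale (*) (\<lambda>x. polar q x y)"
  and polar_linear_right: "Vector_Spaces.linear scale (*) (\<lambda>y. polar q x y)"
  using polar_bilinear by (auto simp: bilinear_map_def)

lemmas polar_add_left = Vector_Spaces.linear.axioms(3)[OF polar_linear_left, THEN module_hom.add]
  and polar_add_right = Vector_Spaces.linear.axioms(3)[OF polar_linear_right, THEN module_hom.add]
  and polar_scale_left = Vector_Spaces.linear.axioms(3)[OF polar_linear_left, THEN module_hom.scale]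
  and polar_scale_right = Vector_Spaces.linear.axioms(3)[OF polar_linear_right, THEN module_hom.scale]
  and polar_diff_right = Vector_Spaces.linear.axioms(3)[OF polar_linear_right, THEN module_hom.diff]

end

context nonsingular_quadratic_space
begin

lemma polar_eqI:
  assumes "\<And>x. polar q x v = polar q x w"
  shows "v = w"
proof -
  have "v - w = 0"
    by (rule nonsingular) (metis polar_sym assms polar_diff_right right_minus_eq)
  then show ?thesis by simp
qed

lemma polar_represents:
  assumes lin: "Vector_Spaces.linear scale (*) \<phi>"
  shows "\<exists>v. \<forall>x. polar q x v = \<phi> x"
proof -
  obtain B0 where B0: "finite B0" "span B0 = UNIV"
    using finite_dim by blast
  obtain B where B: "B \<subseteq> B0" "independent B" "B0 \<subseteq> span B"
    using maximal_independent_subset[of B0] by blast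
  have spanB: "span B = UNIV"
    using span_minimal[OF B(3) subspace_span] B0(2) by auto
  have finB: "finite B" using B(1) B0(1) finite_subset by blast
  interpret fd: finite_dimensional_vector_space scale B
    by unfold_locales (use finB B spanB in auto)
  define T where "T y = (\<Sum>b\<in>B. scale (polar q b y) b)" for y
  have ext: "f = g" if "Vector_Spaces.linear scale (*) f" "Vector_Spaces.linear scale (*) g"
    "\<And>b. b \<in> B \<Longrightarrow> f b = g b" for f g :: "'b \<Rightarrow> 'a"
  proof
    interpret vp: vector_space_pair scale "(*) :: 'a \<Rightarrow> 'a \<Rightarrow> 'a"
      using that(1) by (simp add: Vector_Spaces.linear_def vector_space_pair_def)
    show "f x = g x" for x
      by (rule vp.linear_eq_on[OF that(1,2), of _ B]) (use that spanB in auto)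
  qed
  have coeff: "f = g" if "(\<Sum>b\<in>B. scale (polar q b y) b) = (\<Sum>b\<in>B. scale (g b) b)"
    "f = (\<lambda>x. polar q x y)" "Vector_Spaces.linear scale (*) g" for f g y
  proof -
    have "(\<Sum>b\<in>B. scale (polar q b y - g b) b) = 0"
      using that(1) by (simp add: scale_left_diff_distrib sum_subtractf)
    then have "polar q b y - g b = 0" if "b \<in> B" for b
      using independentD[OF B(2) finB order_refl] that by fastforce
    then show ?thesis
      using that(2,3) ext[OF polar_linear_left that(3), of y] by simp
  qed
  have linT: "Vector_Spaces.linear scale scale T"
    unfolding T_def
    by unfold_locales
      (simp_all add: polar_add_right polar_scale_right scale_left_distrib sum.distrib
        scale_sum_right)
  have "inj T"
  proof (rule injI)
    fix v w assume "T v = T w"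
    then have "(\<lambda>x. polar q x v) = (\<lambda>x. polar q x w)"
      unfolding T_def by (rule coeff[OF _ refl polar_linear_left])
    then show "v = w" by (intro polar_eqI) (rule fun_cong)
  qed
  then have "surj T" by (rule fd.linear_inj_imp_surj[OF linT])
  then obtain v where "(\<Sum>b\<in>B. scale (\<phi> b) b) = T v" by (rule surjE)
  then have "(\<lambda>x. polar q x v) = \<phi>"
    unfolding T_def by (intro coeff[OF _ refl lin]) (rule sym)
  then show ?thesis by (auto dest: fun_cong)
qed

end

text \<open>The description in \<^const>\<open>derived_star1\<close> does determine a map.\<close>

lemma (in quadratic_composition) derived_star1:
  shows "bilinear_map s2 s3 s1 (derived_star1 s1 q1 s2 s3 q3 star3)" (is ?bil)
    and "polar q1 x1 (derived_star1 s1 q1 s2 s3 q3 star3 x2 x3) = polar q3 x3 (star3 x1 x2)"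
      (is ?adj)
proof -
  have star3_lin: "Vector_Spaces.linear s1 s3 (\<lambda>x. star3 x y)"
    "Vector_Spaces.linear s2 s3 (\<lambda>y. star3 x y)" for x y
    using star3_bilinear by (auto simp: bilinear_map_def)
  note star3_simps =
    star3_lin(1)[THEN Vector_Spaces.linear.axioms(3), THEN module_hom.add]
    star3_lin(1)[THEN Vector_Spaces.linear.axioms(3), THEN module_hom.scale]
    star3_lin(2)[THEN Vector_Spaces.linear.axioms(3), THEN module_hom.add]
    star3_lin(2)[THEN Vector_Spaces.linear.axioms(3), THEN module_hom.scale]
  have lin: "Vector_Spaces.linear s1 (*) (\<lambda>x1. polar q3 x3 (star3 x1 x2))" for x2 x3
    using V1.polar_linear_left
    by unfold_locales
      (simp_all add: star3_simps V3.polar_add_right V3.polar_scale_right algebra_simps)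
  define m where "m x2 x3 = (SOME v. \<forall>x1. polar q1 x1 v = polar q3 x3 (star3 x1 x2))" for x2 x3
  have m: "polar q1 x1 (m x2 x3) = polar q3 x3 (star3 x1 x2)" for x1 x2 x3
    using someI_ex[OF V1.polar_represents[OF lin[of x3 x2]]] by (simp add: m_def)
  have "bilinear_map s2 s3 s1 m"
    unfolding bilinear_map_def
    by (intro conjI allI; unfold_locales; rule V1.polar_eqI)
      (simp_all add: m star3_simps V1.polar_add_right V1.polar_scale_right
        V3.polar_add_right V3.polar_scale_right V3.polar_add_left V3.polar_scale_left)
  moreover have "m' = m" if "\<forall>x1 x2 x3. polar q1 x1 (m' x2 x3) = polar q3 x3 (star3 x1 x2)" for m'
    by (intro ext V1.polar_eqI) (simp add: m that)
  ultimately have "derived_star1 s1 q1 s2 s3 q3 star3 = m"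
    unfolding derived_star1_def by (intro the_equality) (auto simp: m)
  then show ?bil ?adj
    using \<open>bilinear_map s2 s3 s1 m\<close> m by simp_all
qed

end

theory Submission
  imports Defs
begin

text \<open>For \<open>u \<in> V\<^sub>1\<close> let \<open>l\<^sub>u\<close> be the map \<open>x\<^sub>2 \<mapsto> u *\<^sub>3 x\<^sub>2\<close> and \<open>r\<^sub>u\<close> its adjoint. Then \<open>r\<^sub>u l\<^sub>u = q\<^sub>1(u)\<close> and
  \<open>l\<^sub>u r\<^sub>u = q\<^sub>1(u)\<close>, so the even Clifford algebra acts on \<open>V\<^sub>2\<close> and \<open>V\<^sub>3\<close>, and the pair
  \<open>(r\<^sub>u l\<^sub>v, l\<^sub>u r\<^sub>v)\<close> lifts \<open>x \<mapsto> b\<^sub>1(v,x) u - b\<^sub>1(u,x) v\<close>. Such maps span the \<open>g\<^sub>1\<close> of multiplier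
  zero. Exchanging the roles of \<open>V\<^sub>1\<close> and \<open>V\<^sub>2\<close>, the analogue of \<open>r\<^sub>u l\<^sub>v\<close> for \<open>u, v \<in> V\<^sub>2\<close> is a
  liftable similitude of \<open>V\<^sub>1\<close> with multiplier \<open>b\<^sub>2(u,v)\<close>, which can be made nonzero in every
  characteristic.\<close>

section \<open>Similitudes of a quadratic space\<close>

context quadratic_space
begin

lemmas polar_diff_left =
  Vector_Spaces.linear.axioms(3)[OF polar_linear_left, THEN module_hom.diff]

lemma polar_self: "polar q x x = 2 * q x"
proof -
  have "x + x = scale 2 x"
    by (metis one_add_one scale_left_distrib scale_one)
  then show ?thesis
    by (simp add: polar_def q_scale)
qed

lemma goI:
  assumes "Vector_Spaces.linear scale scale g" "\<And>u. polar q (g u) u = \<mu> * q u"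
  shows "g \<in> go scale q"
  using assms by (auto simp: go_def)

text \<open>Comparing the condition at \<open>x\<close>, \<open>y\<close> and \<open>x + y\<close>
  puts it in the adjoint form \<open>\<sigma>(g) + g = \<mu>\<close>.\<close>

lemma go_polarize:
  assumes lin: "Vector_Spaces.linear scale scale g" and mu: "\<And>u. polar q (g u) u = \<mu> * q u"
  shows "polar q (g x) y + polar q x (g y) = \<mu> * polar q x y"
proof -
  note [simp] = module_hom.add[OF Vector_Spaces.linear.axioms(3)[OF lin]]
  have q_add: "q (x + y) = polar q x y + q x + q y"
    by (simp add: polar_def)
  show ?thesis
    using mu[of "x + y"] mu[of x] mu[of y]
    by (simp add: polar_add_left polar_add_right q_add polar_sym[of q x "g y"] algebra_simps)
qed

lemma go_add:
  assumes "g \<in> go scale q" "h \<in> go scale q"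
  shows "(\<lambda>x. g x + h x) \<in> go scale q"
proof -
  from assms obtain \<mu> \<nu> where lin: "Vector_Spaces.linear scale scale g"
      "Vector_Spaces.linear scale scale h"
    and mu: "\<And>u. polar q (g u) u = \<mu> * q u" "\<And>u. polar q (h u) u = \<nu> * q u"
    by (auto simp: go_def)
  show ?thesis
  proof (rule goI)
    show "Vector_Spaces.linear scale scale (\<lambda>x. g x + h x)"
      by (intro vector_space_pair.linear_compose_add lin) unfold_locales
    show "polar q (g u + h u) u = (\<mu> + \<nu>) * q u" for u
      by (simp add: mu polar_add_left algebra_simps)
  qed
qed

lemma go_scale:
  assumes "g \<in> go scale q"
  shows "(\<lambda>x. scale c (g x)) \<in> go scale q"
proof -
  from assms obtain \<mu> where lin: "Vector_Spaces.linear scale scale g"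
    and mu: "\<And>u. polar q (g u) u = \<mu> * q u"
    by (auto simp: go_def)
  show ?thesis
  proof (rule goI)
    show "Vector_Spaces.linear scale scale (\<lambda>x. scale c (g x))"
      by (intro vector_space_pair.linear_compose_scale_right lin) unfold_locales
    show "polar q (scale c (g u)) u = (c * \<mu>) * q u" for u
      by (simp add: mu polar_scale_left algebra_simps)
  qed
qed

end

section \<open>Nonsingular forms: uniqueness of multipliers, and wedges as generators of skew
  maps\<close>

context nonsingular_quadratic_space
begin

lemma exists_polar_eq_1:
  assumes "dim UNIV > 0"
  shows "\<exists>u v. polar q u v = 1"
proof -
  have "(UNIV :: 'b set) \<noteq> {0}"
  proof
    assume "(UNIV :: 'b set) = {0}"
    then have "UNIV \<subseteq> span {}"
      by simp
    from basis_card_eq_dim[OF _ this independent_empty] show False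
      using assms by simp
  qed
  then obtain x :: 'b where "x \<noteq> 0"
    by auto
  with nonsingular[of x] obtain y where "polar q x y \<noteq> 0"
    by blast
  then have "polar q x (scale (inverse (polar q x y)) y) = 1"
    by (simp add: polar_scale_right)
  then show ?thesis by blast
qed

lemma exists_anisotropic:
  assumes "dim UNIV > 0"
  shows "\<exists>v. q v \<noteq> 0"
proof (rule ccontr)
  assume "\<nexists>v. q v \<noteq> 0"
  then show False
    using exists_polar_eq_1[OF assms] by (simp add: polar_def)
qed

lemma mu_dot_eq:
  assumes "dim UNIV > 0" "\<And>u. polar q (g u) u = \<mu> * q u"
  shows "mu_dot q g = \<mu>"
proof -
  obtain v where "q v \<noteq> 0"
    using exists_anisotropic[OF assms(1)] ..
  then show ?thesis
    unfolding mu_dot_def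
    by (intro the_equality) (use assms(2) in \<open>auto dest: spec[of _ v]\<close>)
qed

text \<open>Induction on the set of basis vectors that \<open>g\<close> may not kill: subtracting a
  wedge clears one of them. Scalars are absorbed into \<open>u\<close>, so closure under sums
  suffices.\<close>

lemma skew_induct [consumes 2, case_names wedge add]:
  assumes lin: "Vector_Spaces.linear scale scale g" and skew: "\<And>u. polar q (g u) u = 0"
    and wedge: "\<And>u v. P (\<lambda>x. scale (polar q v x) u - scale (polar q u x) v)"
    and add: "\<And>g h. P g \<Longrightarrow> P h \<Longrightarrow> P (\<lambda>x. g x + h x)"
  shows "P g"
proof -
  obtain B where "independent B" and span_B: "span B = UNIV" and "finite B"
    by (metis finite_dim maximal_independent_subset rev_finite_subset span_minimal span_span
        subspace_span top.extremum_uniqueI)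
  interpret vp: vector_space_pair scale scale
    by unfold_locales
  interpret vpf: vector_space_pair scale "(*) :: 'a \<Rightarrow> 'a \<Rightarrow> 'a"
    by (intro vector_space_pair.intro) (unfold_locales, simp_all add: algebra_simps)
  have "P g" if "finite S" "S \<subseteq> B" "Vector_Spaces.linear scale scale g"
    "\<And>u. polar q (g u) u = 0" "\<And>e. e \<in> B - S \<Longrightarrow> g e = 0" for S g
    using that
  proof (induction S arbitrary: g rule: finite_induct)
    case empty
    \<comment> \<open>The zero map is the wedge of two zero vectors.\<close>
    have "g x = scale (polar q 0 x) 0 - scale (polar q 0 x) 0" for x
      using vp.linear_eq_on[OF empty(2) vp.linear_zero, of x B] empty(4) span_B by simp
    then show ?case
      using wedge[of 0 0] by presburger
  next
    case (insert e S)
    note lin_g = module_hom.add[OF Vector_Spaces.linear.axioms(3)[OF insert.prems(2)]]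
      module_hom.scale[OF Vector_Spaces.linear.axioms(3)[OF insert.prems(2)]]
    \<comment> \<open>With \<open>v\<close> dual to the basis vector \<open>e\<close>, the map \<open>w\<close> built from \<open>v\<close> and \<open>g e\<close> agrees with
      \<open>g\<close> at \<open>e\<close> and still vanishes on \<open>B - insert e S\<close>.\<close>
    obtain \<phi> where lin_phi: "Vector_Spaces.linear scale (*) \<phi>"
      and phi: "\<And>x. x \<in> B \<Longrightarrow> \<phi> x = (if x = e then 1 else 0)"
      using vpf.linear_independent_extend[OF \<open>independent B\<close>, of "\<lambda>x. if x = e then 1 else 0"]
      by blast
    obtain v where v: "\<And>x. polar q x v = \<phi> x"
      using polar_represents[OF lin_phi] by blast
    have v': "polar q v x = \<phi> x" for x
      using v polar_sym[of q v x] by simp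
    define w where "w x = scale (polar q v x) (g e) - scale (polar q (g e) x) v" for x
    \<comment> \<open>Skew-adjointness makes \<open>w\<close> vanish at each basis vector
      \<open>x\<close> other than \<open>e\<close> with \<open>g x = 0\<close>.\<close>
    have adj: "polar q (g x) y = - polar q x (g y)" for x y
      using go_polarize[OF insert.prems(2), of 0 x y] insert.prems(3)
      by (simp add: eq_neg_iff_add_eq_0)
    have "P (\<lambda>x. g x + scale (-1) (w x))"
    proof (rule insert.IH)
      show "S \<subseteq> B" using insert.prems by auto
      show "Vector_Spaces.linear scale scale (\<lambda>x. g x + scale (- 1) (w x))"
        unfolding w_def
        by unfold_locales
          (simp_all add: lin_g polar_add_right polar_scale_right algebra_simps)
      show "polar q (g u + scale (-1) (w u)) u = 0" for u
        unfolding w_def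
        by (simp add: insert.prems(3) polar_add_left polar_scale_left polar_diff_left)
      fix x assume x: "x \<in> B - S"
      show "g x + scale (-1) (w x) = 0"
      proof (cases "x = e")
        case True
        then show ?thesis
          using x by (simp add: w_def insert.prems(3) v' phi)
      next
        case False
        then have "g x = 0" using x insert.prems(4) by simp
        moreover have "polar q (g e) x = 0"
          using \<open>g x = 0\<close> adj[of e x] polar_scale_right[of e 0 0] by simp
        ultimately show ?thesis
          using x False by (simp add: w_def v' phi)
      qed
    qed
    from add[OF this wedge[of v "g e"]] show ?case
      by (simp add: w_def)
  qed
  from this[OF \<open>finite B\<close> order_refl lin skew] show ?thesis
    by simp
qed

end

section \<open>Clifford relations between \<open>l\<^sub>u\<close> and
  \<open>r\<^sub>u\<close>\<close>

context quadratic_composition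
begin

text \<open>Carries results on multiplication by vectors of \<open>V\<^sub>1\<close> over to vectors
  of \<open>V\<^sub>2\<close>.\<close>

lemma swap: "quadratic_composition s2 q2 s1 q1 s3 q3 (\<lambda>x2 x1. star3 x1 x2) n"
  by unfold_locales
    (use dim1 dim2 dim3 star3_bilinear star3_mult in \<open>auto simp: bilinear_map_def mult.commute\<close>)

lemma star3_linear:
  shows "Vector_Spaces.linear s1 s3 (\<lambda>x. star3 x y)"
    and "Vector_Spaces.linear s2 s3 (\<lambda>y. star3 x y)"
  using star3_bilinear by (auto simp: bilinear_map_def)

lemmas star3_simps =
  star3_linear(1)[THEN Vector_Spaces.linear.axioms(3), THEN module_hom.add]
  star3_linear(1)[THEN Vector_Spaces.linear.axioms(3), THEN module_hom.scale]
  star3_linear(1)[THEN Vector_Spaces.linear.axioms(3), THEN module_hom.diff]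
  star3_linear(2)[THEN Vector_Spaces.linear.axioms(3), THEN module_hom.add]
  star3_linear(2)[THEN Vector_Spaces.linear.axioms(3), THEN module_hom.scale]
  star3_linear(2)[THEN Vector_Spaces.linear.axioms(3), THEN module_hom.diff]

text \<open>The second derived map, with \<open>r\<^sub>u y = star2 y u\<close>, obtained as the
  first derived map of the swapped composition.\<close>

definition star2 where
  "star2 x3 x1 = derived_star1 s2 q2 s1 s3 q3 (\<lambda>x2 x1. star3 x1 x2) x1 x3"

lemma polar_star2: "polar q2 x2 (star2 x3 x1) = polar q3 x3 (star3 x1 x2)"
  unfolding star2_def by (rule quadratic_composition.derived_star1(2)[OF swap])

lemma star2_bilinear: "bilinear_map s1 s3 s2 (\<lambda>x1 x3. star2 x3 x1)"
  unfolding star2_def by (rule quadratic_composition.derived_star1(1)[OF swap])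

lemma star2_linear:
  shows "Vector_Spaces.linear s1 s2 (\<lambda>x. star2 y x)"
    and "Vector_Spaces.linear s3 s2 (\<lambda>y. star2 y x)"
  using star2_bilinear by (auto simp: bilinear_map_def)

lemmas star2_simps =
  star2_linear(1)[THEN Vector_Spaces.linear.axioms(3), THEN module_hom.add]
  star2_linear(1)[THEN Vector_Spaces.linear.axioms(3), THEN module_hom.scale]
  star2_linear(2)[THEN Vector_Spaces.linear.axioms(3), THEN module_hom.add]
  star2_linear(2)[THEN Vector_Spaces.linear.axioms(3), THEN module_hom.scale]
  star2_linear(2)[THEN Vector_Spaces.linear.axioms(3), THEN module_hom.diff]

lemma polar_star3: "polar q3 (star3 u x) (star3 u y) = q1 u * polar q2 x y"
  using star3_mult[of u "x + y"] by (simp add: polar_def star3_simps star3_mult algebra_simps)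

lemma polar_star3_cross:
  "polar q3 (star3 u x) (star3 v y) + polar q3 (star3 v x) (star3 u y) = polar q1 u v * polar q2 x y"
  using polar_star3[of "u + v" x y] polar_star3[of u x y] polar_star3[of v x y]
  by (simp add: star3_simps V3.polar_add_left V3.polar_add_right polar_def[of q1] algebra_simps)

lemma star2_star3: "star2 (star3 u x) u = s2 (q1 u) x"
  by (rule V2.polar_eqI) (simp add: polar_star2 polar_star3 V2.polar_scale_right polar_sym[of q2 x])

lemma star2_star3_cross: "star2 (star3 v x) u + star2 (star3 u x) v = s2 (polar q1 u v) x"
  by (rule V2.polar_eqI)
    (simp add: polar_star2 V2.polar_add_right V2.polar_scale_right polar_sym[of q2 _ x]
      polar_star3_cross add.commute flip: polar_star3_cross)

text \<open>Polarizing multiplicativity at \<open>u + v\<close> with \<open>x\<close> fixed yields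
  \<open>q2 x\<close> itself; \<open>polar_star3_cross\<close> with \<open>y = x\<close> would only
  give twice this, which is empty in characteristic 2.\<close>

lemma polar_star2_star3: "polar q2 x (star2 (star3 v x) u) = polar q1 u v * q2 x"
proof -
  have "polar q2 x (star2 (star3 v x) u) = polar q3 (star3 v x) (star3 u x)"
    by (rule polar_star2)
  then show ?thesis
    using star3_mult[of "u + v" x]
    by (simp add: polar_def star3_simps star3_mult algebra_simps)
qed

text \<open>Up to the nonzero scalar \<open>q1 v\<close>, \<open>r\<^sub>v\<close> is a left inverse
  of \<open>l\<^sub>v\<close>; equal dimensions turn injectivity into surjectivity.\<close>

lemma surj_star3:
  assumes "q1 v \<noteq> 0"
  shows "surj (star3 v)"
proof -
  obtain B2 where B2: "finite B2" "V2.independent B2" "V2.span B2 = UNIV"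
    by (metis V2.finite_dim V2.maximal_independent_subset rev_finite_subset V2.span_minimal
        V2.span_span V2.subspace_span top.extremum_uniqueI)
  obtain B3 where B3: "finite B3" "V3.independent B3" "V3.span B3 = UNIV"
    by (metis V3.finite_dim V3.maximal_independent_subset rev_finite_subset V3.span_minimal
        V3.span_span V3.subspace_span top.extremum_uniqueI)
  interpret finite_dimensional_vector_space_pair s2 B2 s3 B3
    by unfold_locales (use B2 B3 in auto)
  have "inj (star3 v)"
  proof (rule injI)
    fix x y assume "star3 v x = star3 v y"
    then have "s2 (q1 v) x = s2 (q1 v) y"
      by (metis star2_star3)
    then show "x = y"
      using assms by simp
  qed
  then show ?thesis
    using linear_injective_imp_surjective[OF star3_linear(2)] dim2 dim3 by simp
qed

lemma star3_star2_anisotropic: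
  assumes "q1 v \<noteq> 0"
  shows "star3 v (star2 y v) = s3 (q1 v) y"
proof -
  obtain x where "y = star3 v x"
    using surj_star3[OF assms] by (rule surjE)
  then show ?thesis
    by (simp add: star2_star3 star3_simps)
qed

text \<open>If \<open>u\<close> is isotropic, \<open>l\<^sub>u\<close> is not invertible, so the identity is transported from an
  anisotropic vector \<open>v\<close>.\<close>

lemma star3_star2_cross_anisotropic:
  assumes "q1 v \<noteq> 0"
  shows "star3 u (star2 y v) + star3 v (star2 y u) = s3 (polar q1 u v) y"
proof -
  have "star2 (star3 u (star2 y v)) v = s2 (polar q1 u v) (star2 y v) - s2 (q1 v) (star2 y u)"
    using star2_star3_cross[of v "star2 y v" u]
    by (simp add: star3_star2_anisotropic[OF assms] star2_simps algebra_simps)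
  \<comment> \<open>Applying \<open>l\<^sub>v\<close> turns each \<open>l\<^sub>v r\<^sub>v\<close>
    into \<open>q1 v\<close>, a factor that is then cancelled.\<close>
  then have "star3 v (star2 (star3 u (star2 y v)) v) =
      star3 v (s2 (polar q1 u v) (star2 y v) - s2 (q1 v) (star2 y u))"
    by simp
  then have "s3 (q1 v) (star3 u (star2 y v)) =
      s3 (q1 v) (s3 (polar q1 u v) y - star3 v (star2 y u))"
    by (simp add: star3_star2_anisotropic[OF assms] star3_simps V3.scale_right_diff_distrib
      mult.commute)
  then show ?thesis
    using assms by simp
qed

lemma star3_star2:
  assumes "n > 0"
  shows "star3 u (star2 y u) = s3 (q1 u) y"
proof -
  obtain v where v: "q1 v \<noteq> 0"
    using V1.exists_anisotropic assms dim1 by auto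
  \<comment> \<open>Insert \<open>l\<^sub>v r\<^sub>v\<close> for \<open>q1 v\<close>; two cross
    relations then turn \<open>l\<^sub>u r\<^sub>u l\<^sub>v r\<^sub>v\<close> into
    \<open>l\<^sub>v r\<^sub>u l\<^sub>u r\<^sub>v\<close>, where \<open>r\<^sub>u l\<^sub>u\<close>
    is known.\<close>
  have "s3 (q1 v) (star3 u (star2 y u)) = star3 u (star2 (star3 v (star2 y v)) u)"
    by (simp add: star3_star2_anisotropic[OF v] star2_simps star3_simps)
  also have "star2 (star3 v (star2 y v)) u =
      s2 (polar q1 u v) (star2 y v) - star2 (star3 u (star2 y v)) v"
    using star2_star3_cross[of v "star2 y v" u] by (simp add: eq_diff_eq)
  also have "star3 u \<dots> =
      s3 (polar q1 u v) (star3 u (star2 y v)) - star3 u (star2 (star3 u (star2 y v)) v)"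
    by (simp add: star3_simps)
  also have "\<dots> = star3 v (star2 (star3 u (star2 y v)) u)"
    using star3_star2_cross_anisotropic[OF v, of u "star3 u (star2 y v)"]
    by (simp add: diff_eq_eq add.commute)
  also have "\<dots> = s3 (q1 v) (s3 (q1 u) y)"
    by (simp add: star2_star3 star3_simps star3_star2_anisotropic[OF v] mult.commute)
  finally show ?thesis
    using v by (simp del: V3.scale_scale)
qed

lemma star3_star2_cross:
  assumes "n > 0"
  shows "star3 u (star2 y v) + star3 v (star2 y u) = s3 (polar q1 u v) y"
  using star3_star2[OF assms, of "u + v" y]
  by (simp add: star3_simps star2_simps star3_star2[OF assms] polar_def[of q1] algebra_simps)

text \<open>The polar form does not determine \<open>q2\<close> in characteristic 2, so
  \<open>q2\<close> is expanded directly on \<open>r\<^sub>u l\<^sub>v x = b\<^sub>1(u,v) x -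
  r\<^sub>v l\<^sub>u x\<close>, with \<open>v\<close> anisotropic.\<close>

lemma star2_mult:
  assumes "n > 0"
  shows "q2 (star2 y u) = q1 u * q3 y"
proof -
  obtain v where v: "q1 v \<noteq> 0"
    using V1.exists_anisotropic assms dim1 by auto
  have anisotropic: "q2 (star2 y v) = q1 v * q3 y" for y
  proof -
    obtain x where "y = star3 v x"
      using surj_star3[OF v] by (rule surjE)
    then show ?thesis
      by (simp add: star2_star3 V2.q_scale star3_mult power2_eq_square)
  qed
  obtain x where x: "y = star3 v x"
    using surj_star3[OF v] by (rule surjE)
  define z where "z = star2 (star3 u x) v"
  have y: "star2 y u = s2 (polar q1 u v) x + s2 (-1) z"
    using star2_star3_cross[of v x u] by (simp add: x z_def eq_diff_eq)
  moreover have "q2 z = q1 v * (q1 u * q2 x)"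
    by (simp add: z_def anisotropic star3_mult)
  moreover have "polar q2 x z = polar q1 u v * q2 x"
    by (simp add: z_def polar_star2_star3 polar_sym[of q1 v])
  moreover have "q2 (s2 c x + s2 (-1) z) = c\<^sup>2 * q2 x + q2 z - c * polar q2 x z" for c
  proof -
    have "q2 (a + b) = q2 a + q2 b + polar q2 a b" for a b
      by (simp add: polar_def)
    then show ?thesis
      by (simp add: V2.q_scale V2.polar_scale_left V2.polar_scale_right
          del: V2.scale_minus_left)
  qed
  ultimately show ?thesis
    unfolding y by (simp add: x star3_mult power2_eq_square)
qed

lemma polar_star2_cross:
  assumes "n > 0"
  shows "polar q3 (star3 u (star2 y v)) y = polar q1 u v * q3 y"
proof -
  have "polar q3 (star3 u (star2 y v)) y = polar q2 (star2 y v) (star2 y u)"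
    by (simp add: polar_sym[of q3 _ y] polar_star2)
  then show ?thesis
    using star2_mult[OF assms, of y "u + v"]
    by (simp add: polar_def star2_simps star2_mult[OF assms] algebra_simps)
qed

section \<open>Liftable similitudes of \<open>V\<^sub>1\<close>\<close>

text \<open>For a related triple with \<open>g\<^sub>3\<close> of multiplier \<open>\<nu>\<close>, taking adjoints shows that
  \<open>(g\<^sub>1, g\<^sub>2, g\<^sub>3 - \<nu>)\<close> satisfies the identity for \<open>*\<^sub>1\<close> with its correction term \<open>\<mu>(g\<^sub>1)\<close>.\<close>

definition "related g1 g2 g3 \<longleftrightarrow>
  (\<forall>x1 x2. g3 (star3 x1 x2) = star3 (g1 x1) x2 + star3 x1 (g2 x2))"

definition "liftable g1 \<longleftrightarrow> (\<exists>g2 \<in> go s2 q2. \<exists>g3 \<in> go s3 q3. related g1 g2 g3)"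

lemma liftable_add:
  assumes "liftable g" "liftable h"
  shows "liftable (\<lambda>x. g x + h x)"
proof -
  from assms obtain g2 g3 h2 h3 where go: "g2 \<in> go s2 q2" "h2 \<in> go s2 q2"
      "g3 \<in> go s3 q3" "h3 \<in> go s3 q3"
    and "related g g2 g3" "related h h2 h3"
    by (auto simp: liftable_def)
  then have "related (\<lambda>x. g x + h x) (\<lambda>x. g2 x + h2 x) (\<lambda>x. g3 x + h3 x)"
    by (simp add: related_def star3_simps)
  then show ?thesis
    using V2.go_add[OF go(1,2)] V3.go_add[OF go(3,4)] unfolding liftable_def by blast
qed

lemma liftable_scale:
  assumes "liftable g"
  shows "liftable (\<lambda>x. s1 c (g x))"
proof -
  from assms obtain g2 g3 where go: "g2 \<in> go s2 q2" "g3 \<in> go s3 q3" and "related g g2 g3"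
    by (auto simp: liftable_def)
  then have "related (\<lambda>x. s1 c (g x)) (\<lambda>x. s2 c (g2 x)) (\<lambda>x. s3 c (g3 x))"
    by (simp add: related_def star3_simps V3.scale_right_distrib)
  then show ?thesis
    using V2.go_scale[OF go(1)] V3.go_scale[OF go(2)] unfolding liftable_def by blast
qed

text \<open>Cross relations turn \<open>l\<^sub>u r\<^sub>v l\<^sub>x\<close> into
  \<open>l\<^sub>x r\<^sub>u l\<^sub>v\<close> plus two scalar terms, and these form the
  wedge.\<close>

lemma related_wedge:
  assumes "n > 0"
  shows "related (\<lambda>x. s1 (polar q1 v x) u - s1 (polar q1 u x) v)
    (\<lambda>x. star2 (star3 v x) u) (\<lambda>y. star3 u (star2 y v))"
  unfolding related_def
proof (intro allI)
  fix x1 x2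
  have "star2 (star3 x1 x2) v = s2 (polar q1 v x1) x2 - star2 (star3 v x2) x1"
    using star2_star3_cross[of v x2 x1] by (simp add: eq_diff_eq add.commute polar_sym[of q1 v])
  moreover have "star3 u (star2 (star3 v x2) x1) =
      s3 (polar q1 u x1) (star3 v x2) - star3 x1 (star2 (star3 v x2) u)"
    using star3_star2_cross[OF assms, of u "star3 v x2" x1] by (simp add: eq_diff_eq)
  ultimately show "star3 u (star2 (star3 x1 x2) v) =
      star3 (s1 (polar q1 v x1) u - s1 (polar q1 u x1) v) x2 + star3 x1 (star2 (star3 v x2) u)"
    by (simp add: star3_simps)
qed

lemma star2_star3_go:
  shows "Vector_Spaces.linear s2 s2 (\<lambda>x. star2 (star3 v x) u)"
    and "polar q2 (star2 (star3 v x) u) x = polar q1 u v * q2 x"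
proof -
  show "Vector_Spaces.linear s2 s2 (\<lambda>x. star2 (star3 v x) u)"
    by unfold_locales (simp_all add: star2_simps star3_simps)
  show "polar q2 (star2 (star3 v x) u) x = polar q1 u v * q2 x"
    by (simp add: polar_sym[of q2 _ x] polar_star2_star3)
qed

lemma star3_star2_go:
  assumes "n > 0"
  shows "(\<lambda>y. star3 u (star2 y v)) \<in> go s3 q3"
  by (rule V3.goI[OF _ polar_star2_cross[OF assms]])
    (unfold_locales, simp_all add: star2_simps star3_simps)

lemma wedge_go:
  "(\<lambda>x. s1 (polar q1 v x) u - s1 (polar q1 u x) v) \<in> go s1 q1"
proof (rule V1.goI)
  show "Vector_Spaces.linear s1 s1 (\<lambda>x. s1 (polar q1 v x) u - s1 (polar q1 u x) v)"
    by unfold_locales (simp_all add: V1.polar_add_right V1.polar_scale_right algebra_simps)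
  show "polar q1 (s1 (polar q1 v x) u - s1 (polar q1 u x) v) x = 0 * q1 x" for x
    by (simp add: polar_sym[of q1 _ x] V1.polar_diff_right V1.polar_scale_right)
qed

lemma liftable_wedge:
  assumes "n > 0"
  shows "liftable (\<lambda>x. s1 (polar q1 v x) u - s1 (polar q1 u x) v)"
  unfolding liftable_def
  using related_wedge[OF assms] star3_star2_go[OF assms] V2.goI[OF star2_star3_go] by blast

text \<open>Scalar maps cannot serve here in characteristic 2, where the identity has multiplier
  \<open>2 = 0\<close>.\<close>

lemma liftable_multiplier_1:
  assumes "n > 0"
  shows "\<exists>g. liftable g \<and> Vector_Spaces.linear s1 s1 g \<and> (\<forall>x. polar q1 (g x) x = q1 x)"
proof -
  interpret swap: quadratic_composition s2 q2 s1 q1 s3 q3 "\<lambda>x2 x1. star3 x1 x2" n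
    by (rule swap)
  obtain u v where uv: "polar q2 u v = 1"
    using V2.exists_polar_eq_1 assms dim2 by auto
  define g where "g x = swap.star2 (star3 x v) u" for x
  \<comment> \<open>The swapped triple has the wedge first and \<open>g\<close> second; the relation
    is symmetric in these two summands.\<close>
  have "related g (\<lambda>x. s2 (polar q2 v x) u - s2 (polar q2 u x) v) (\<lambda>y. star3 (swap.star2 y v) u)"
    using swap.related_wedge[OF assms, of v u]
    by (simp add: related_def swap.related_def g_def add.commute)
  then have "liftable g"
    unfolding liftable_def using swap.wedge_go swap.star3_star2_go[OF assms] by blast
  then show ?thesis
    using swap.star2_star3_go[where u=u and v=v] uv unfolding g_def by auto
qed

text \<open>Subtracting \<open>\<mu>\<close> times a liftable map of multiplier 1 leaves a skew map,
  hence a sum of wedges.\<close>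

lemma liftable_go:
  assumes "n > 0" "g \<in> go s1 q1"
  shows "liftable g"
proof -
  from assms(2) obtain \<mu> where lin: "Vector_Spaces.linear s1 s1 g"
    and mu: "\<And>x. polar q1 (g x) x = \<mu> * q1 x"
    by (auto simp: go_def)
  obtain h where h: "liftable h" "Vector_Spaces.linear s1 s1 h" "\<And>x. polar q1 (h x) x = q1 x"
    using liftable_multiplier_1[OF assms(1)] by blast
  have "Vector_Spaces.linear s1 s1 (\<lambda>x. g x + s1 (- \<mu>) (h x))"
    by (intro vector_space_pair.linear_compose_add vector_space_pair.linear_compose_scale_right lin h)
      unfold_locales
  then have "liftable (\<lambda>x. g x + s1 (- \<mu>) (h x))"
    by (rule V1.skew_induct)
      (simp_all add: mu h(3) V1.polar_add_left V1.polar_scale_left liftable_wedge[OF assms(1)]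
        liftable_add del: V1.scale_minus_left)
  from liftable_add[OF this liftable_scale[OF h(1), of \<mu>]] show ?thesis
    by simp
qed

end

section \<open>Passing from \<open>*\<^sub>3\<close> to \<open>*\<^sub>1\<close> by
  adjunction\<close>

theorem corollary3p25:
  fixes s1 :: "'f::field \<Rightarrow> 'a::ab_group_add \<Rightarrow> 'a" and q1 :: "'a \<Rightarrow> 'f"
    and s2 :: "'f \<Rightarrow> 'b::ab_group_add \<Rightarrow> 'b" and q2 :: "'b \<Rightarrow> 'f"
    and s3 :: "'f \<Rightarrow> 'c::ab_group_add \<Rightarrow> 'c" and q3 :: "'c \<Rightarrow> 'f"
    and star3 :: "'a \<Rightarrow> 'b \<Rightarrow> 'c" and star1 :: "'b \<Rightarrow> 'c \<Rightarrow> 'a"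
    and g1 :: "'a \<Rightarrow> 'a"
  assumes "quadratic_composition s1 q1 s2 q2 s3 q3 star3 8"
    and "star1 = derived_star1 s1 q1 s2 s3 q3 star3"
    and "g1 \<in> go s1 q1"
  shows "\<exists>g2 \<in> go s2 q2. \<exists>g3 \<in> go s3 q3. \<forall>x2 x3.
           g1 (star1 x2 x3) =
             star1 (g2 x2) x3 + star1 x2 (g3 x3) + s1 (mu_dot q1 g1) (star1 x2 x3)"
proof -
  interpret quadratic_composition s1 q1 s2 q2 s3 q3 star3 8
    by (fact assms(1))
  have adj: "polar q1 x1 (star1 x2 x3) = polar q3 x3 (star3 x1 x2)" for x1 x2 x3
    unfolding assms(2) by (rule derived_star1)
  obtain g2 h3 where g2: "g2 \<in> go s2 q2" and h3: "h3 \<in> go s3 q3" and rel: "related g1 g2 h3"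
    using liftable_go[OF _ assms(3)] by (auto simp: liftable_def)
  obtain \<mu> where lin1: "Vector_Spaces.linear s1 s1 g1"
    and mu: "\<And>x. polar q1 (g1 x) x = \<mu> * q1 x"
    using assms(3) by (auto simp: go_def)
  obtain \<nu> where lin3: "Vector_Spaces.linear s3 s3 h3"
    and nu: "\<And>x. polar q3 (h3 x) x = \<nu> * q3 x"
    using h3 by (auto simp: go_def)
  have mu_dot: "mu_dot q1 g1 = \<mu>"
    using V1.mu_dot_eq[OF _ mu] dim1 by simp
  define g3 where "g3 x = h3 x + s3 (- \<nu>) x" for x
  \<comment> \<open>The identity is a similitude of multiplier 2, so the shift by
    \<open>\<nu>\<close> stays in \<open>go\<close>.\<close>
  have "g3 \<in> go s3 q3"
    unfolding g3_def
    by (intro V3.go_add h3 V3.go_scale V3.goI[where g="\<lambda>x. x", OF V3.linear_ident V3.polar_self])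
  moreover have "g1 (star1 x2 x3) =
      star1 (g2 x2) x3 + star1 x2 (g3 x3) + s1 (mu_dot q1 g1) (star1 x2 x3)" for x2 x3
  \<comment> \<open>Pairing with \<open>x1\<close> turns every \<open>star1\<close> into a
    \<open>star3\<close>; fact 1 moves \<open>g1\<close> across \<open>b\<^sub>1\<close>, and fact 2
    is the triple relation with \<open>h3\<close> moved across \<open>b\<^sub>3\<close>.\<close>
  proof (rule V1.polar_eqI)
    fix x1
    have 1: "polar q1 x1 (g1 (star1 x2 x3)) =
        \<mu> * polar q3 x3 (star3 x1 x2) - polar q3 x3 (star3 (g1 x1) x2)"
      using V1.go_polarize[OF lin1 mu, of x1 "star1 x2 x3"] by (simp add: adj eq_diff_eq add.commute)
    have 2: "polar q3 (h3 x3) (star3 x1 x2) + polar q3 x3 (star3 (g1 x1) x2)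
        + polar q3 x3 (star3 x1 (g2 x2)) = \<nu> * polar q3 x3 (star3 x1 x2)"
      using V3.go_polarize[OF lin3 nu, of x3 "star3 x1 x2"] rel
      by (simp add: related_def V3.polar_add_right add.assoc)
    show "polar q1 x1 (g1 (star1 x2 x3)) = polar q1 x1
        (star1 (g2 x2) x3 + star1 x2 (g3 x3) + s1 (mu_dot q1 g1) (star1 x2 x3))"
      by (simp add: V1.polar_add_right V1.polar_scale_right adj g3_def V3.polar_add_left
        V3.polar_scale_left mu_dot 1 flip: 2 del: V3.scale_minus_left)
  qed
  ultimately show ?thesis
    using g2 by blast
qed

end
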